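(* Let $q\in[1,\infty)$. Consider the single DRCCP ($I=1$) under the type $q$-Wasserstein ambiguity set with affine mappings $a_1(x)=x$, $b_1(x)=b_1$ (a constant) and elliptical reference distribution $\tilde\zeta\sim\mathbb{P}_{\mathrm E}(\mu,\Sigma,\hat g)$, i.e. $$v_q^*=\min_{x\in\mathcal X}\{c^\top x:\mu^\top x+\eta_q^*\sqrt{x^\top\Sigma x}-b_1\le0\}.$$ Suppose that $\mathcal X\subseteq\{0,1\}^n$, $\mu\ge0$ (componentwise), $\Sigma=\mathrm{Diag}(\mu)$, and $\eta_q^*\ge0$. Then ALSO-X# is exact, i.e., $v_q^{A\#}=v_q^*$.
   Context: $c\in\mathbb{R}^n$, $b_1\in\mathbb{R}$, $\varepsilon\in(0,1)$, $\theta\ge0$, $(y)_+=\max\{y,0\}$; $\mathrm{Diag}(\mu)$ is the diagonal matrix with diagonal $\mu$. The norm defining the Wasserstein distance is the generalized Mahalanobis norm $\|y\|=\sqrt{y^\top\Sigma^\dagger y}$ ($\Sigma^\dagger$ the pseudo-inverse), whose dual norm is taken to be $\|x\|_*=\sqrt{x^\top\Sigma x}$. Elliptical distribution $\mathbb{P}_{\mathrm E}(\mu,\Sigma,\hat g)$: location $\mu\in\mathbb{R}^n$, positive semidefinite $\Sigma$, generating function $\hat g$, density $\bar k\,\hat g(\frac12(x-\mu)^\top\Sigma^{-1}(x-\mu))$, $\bar k>0$ a normalization constant; the standard univariate one has density $\bar k\hat g(z^2/2)$ and cumulative distribution function $\Phi$. In general (also for singular $\Sigma$), for every $x$, $x^\top\tilde\zeta$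 has the law of $\mu^\top x+\sqrt{x^\top\Sigma x}\,Z$ with $Z\sim\mathbb{P}_{\mathrm E}(0,1,\hat g)$. The reference distribution $\mathbb{P}_\zeta$ of $\tilde\zeta$ is assumed sub-Gaussian. $$\eta_q^*=\min_\eta\Big\{\eta:\int_{\Phi^{-1}(1-\varepsilon)}^{\eta}(\eta-t)^q\,\bar k\hat g(t^2/2)\,dt\ge\theta^q,\ \eta\ge\Phi^{-1}(1-\varepsilon)\Big\}.$$ For $q>1$, $P_q(x,\lambda)=\|x\|_*^{\frac q{q-1}}\lambda^{-\frac1{q-1}}q^{-\frac q{q-1}}(q-1)$ (for $\lambda=0$: $0$ if $\|x\|_*=0$, else $+\infty$); for $q=1$, $P_1(x,\lambda)=0$ if $\|x\|_*\le\lambda$ and $+\infty$ otherwise. ALSO-X#: $v_q^{A\#}$ is the minimum (infimum) of all $t$ for which there is an optimal solution $(x^*,\lambda^*,\beta^* )$ of $\min\{\varepsilon\beta+\lambda\theta^q+\mathbb{E}_{\mathbb{P}_\zeta}[(x^\top\tilde\zeta-b_1+P_q(x,\lambda)-\beta)_+]:x\in\mathcal X,\ c^\top x\le t,\ \lambda\ge0,\ \beta\le0\}$ such that $x^*$ satisfies the worst-case chance constraint, i.e. $\mu^\top x^*+\eta_q^*\sqrt{(x^* )^\top\Sigma x^*}\le b_1$. Conventions: an infimum over the empty set is $+\infty$; the minimization problems are understood to attain their minima whenever feasible. *)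

theory Defs
  imports "HOL-Probability.Probability"
begin

definition Diag :: "real ^ 'n \<Rightarrow> real ^ 'n ^ 'n" where
  "Diag m = (\<chi> i j. if i = j then m $ i else 0)"

definition psd :: "real ^ 'n ^ 'n \<Rightarrow> bool" where
  "psd S \<longleftrightarrow> transpose S = S \<and> (\<forall>x. 0 \<le> x \<bullet> (S *v x))"

definition generating_function :: "(real \<Rightarrow> real) \<Rightarrow> bool" where
  "generating_function g \<longleftrightarrow>
     (\<forall>u\<ge>0. 0 \<le> g u) \<and>
     integrable lborel (\<lambda>z::real. g (z\<^sup>2 / 2)) \<and>
     0 < (\<integral>z. g (z\<^sup>2 / 2) \<partial>lborel)"

definition norm_const :: "(real \<Rightarrow> real) \<Rightarrow> real" where
  "norm_const g = 1 / (\<integral>z. g (z\<^sup>2 / 2) \<partial>lborel)"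

definition std_density :: "(real \<Rightarrow> real) \<Rightarrow> real \<Rightarrow> real" where
  "std_density g z = norm_const g * g (z\<^sup>2 / 2)"

definition std_elliptical :: "(real \<Rightarrow> real) \<Rightarrow> real measure" where
  "std_elliptical g = density lborel (\<lambda>z. ennreal (std_density g z))"

text \<open>A law on \<open>\<real>\<^sup>n\<close> is determined by its one-dimensional projections (Cramer-Wold), so the
  projections are used to define the elliptical law with location \<open>m\<close> and matrix \<open>S\<close>. Unlike a
  joint density, which would involve the inverse of \<open>S\<close>, this makes sense for singular \<open>S\<close>. A
  joint density built from the same \<open>g\<close> as the univariate one is deliberately not
  required in addition: in dimension at least two, a generating function that
  describes both the joint law and its univariate margins is essentially Gaussian.\<close>

definition elliptical ::
  "(real ^ 'n) measure \<Rightarrow> real ^ 'n \<Rightarrow> real ^ 'n ^ 'n \<Rightarrow> (real \<Rightarrow> real) \<Rightarrow> bool" where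
  "elliptical P m S g \<longleftrightarrow>
     prob_space P \<and> sets P = sets borel \<and> psd S \<and> generating_function g \<and>
     (\<forall>x. distr P borel (\<lambda>\<zeta>. x \<bullet> \<zeta>) =
          distr (std_elliptical g) borel (\<lambda>z. m \<bullet> x + sqrt (x \<bullet> (S *v x)) * z))"

definition sub_gaussian :: "(real ^ 'n) measure \<Rightarrow> bool" where
  "sub_gaussian P \<longleftrightarrow>
     (\<exists>C1>0. \<exists>C2>0. \<forall>t\<ge>0. measure P {\<zeta> \<in> space P. t \<le> norm \<zeta>} \<le> C1 * exp (- C2 * t\<^sup>2))"

text \<open>The distribution function of a generating function need not be strictly increasing; its
  inverse is the lower quantile function.\<close>

definition quantile :: "(real \<Rightarrow> real) \<Rightarrow> real \<Rightarrow> real" where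
  "quantile g p = Inf {t. p \<le> cdf (std_elliptical g) t}"

definition eta_star :: "(real \<Rightarrow> real) \<Rightarrow> real \<Rightarrow> real \<Rightarrow> real \<Rightarrow> real" where
  "eta_star g \<epsilon> \<theta> q =
     Inf {\<eta>. \<theta> powr q \<le> (LBINT t:{quantile g (1 - \<epsilon>)..\<eta>}. (\<eta> - t) powr q * std_density g t) \<and>
             quantile g (1 - \<epsilon>) \<le> \<eta>}"

definition wc_chance_constraint ::
  "(real \<Rightarrow> real) \<Rightarrow> real \<Rightarrow> real \<Rightarrow> real \<Rightarrow> real ^ 'n \<Rightarrow> real ^ 'n ^ 'n \<Rightarrow> real \<Rightarrow> real ^ 'n \<Rightarrow> bool" where
  "wc_chance_constraint g \<epsilon> \<theta> q m S b x \<longleftrightarrow>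
     m \<bullet> x + eta_star g \<epsilon> \<theta> q * sqrt (x \<bullet> (S *v x)) - b \<le> 0"

text \<open>The infimum is taken in the extended reals, where the infimum of the empty set is \<open>\<infinity>\<close>.\<close>

definition v_star ::
  "(real \<Rightarrow> real) \<Rightarrow> real \<Rightarrow> real \<Rightarrow> real \<Rightarrow> real ^ 'n \<Rightarrow> real ^ 'n \<Rightarrow> real ^ 'n ^ 'n \<Rightarrow> real \<Rightarrow>
   (real ^ 'n) set \<Rightarrow> ereal" where
  "v_star g \<epsilon> \<theta> q c m S b X =
     (INF x\<in>{x \<in> X. wc_chance_constraint g \<epsilon> \<theta> q m S b x}. ereal (c \<bullet> x))"

text \<open>The dual of the generalized Mahalanobis norm given by the pseudo-inverse of \<open>S\<close>.\<close>

definition dual_norm :: "real ^ 'n ^ 'n \<Rightarrow> real ^ 'n \<Rightarrow> real" where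
  "dual_norm S x = sqrt (x \<bullet> (S *v x))"

definition penalty :: "real \<Rightarrow> real ^ 'n ^ 'n \<Rightarrow> real ^ 'n \<Rightarrow> real \<Rightarrow> ereal" where
  "penalty q S x l =
     (if q = 1 then (if dual_norm S x \<le> l then 0 else \<infinity>)
      else if l = 0 then (if dual_norm S x = 0 then 0 else \<infinity>)
      else ereal (dual_norm S x powr (q / (q - 1)) * l powr (- 1 / (q - 1)) *
                  q powr (- q / (q - 1)) * (q - 1)))"

text \<open>The integrand is nonnegative and may take the value \<open>\<infinity>\<close> through the penalty, so the
  expectation is a nonnegative integral.\<close>

definition alsox_objective ::
  "(real ^ 'n) measure \<Rightarrow> real \<Rightarrow> real \<Rightarrow> real \<Rightarrow> real ^ 'n ^ 'n \<Rightarrow> real \<Rightarrow>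
   (real ^ 'n) \<times> real \<times> real \<Rightarrow> ereal" where
  "alsox_objective P \<epsilon> \<theta> q S b = (\<lambda>(x, l, \<beta>).
     ereal (\<epsilon> * \<beta> + l * \<theta> powr q) +
     enn2ereal (\<integral>\<^sup>+\<zeta>. e2ennreal (max 0 (ereal (x \<bullet> \<zeta> - b) + penalty q S x l - ereal \<beta>)) \<partial>P))"

definition alsox_feasible ::
  "real ^ 'n \<Rightarrow> (real ^ 'n) set \<Rightarrow> real \<Rightarrow> (real ^ 'n) \<times> real \<times> real \<Rightarrow> bool" where
  "alsox_feasible c X t = (\<lambda>(x, l, \<beta>). x \<in> X \<and> c \<bullet> x \<le> t \<and> 0 \<le> l \<and> \<beta> \<le> 0)"

definition alsox_optimal ::
  "(real ^ 'n) measure \<Rightarrow> real \<Rightarrow> real \<Rightarrow> real \<Rightarrow> real ^ 'n \<Rightarrow> real ^ 'n ^ 'n \<Rightarrow> real \<Rightarrow>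
   (real ^ 'n) set \<Rightarrow> real \<Rightarrow> (real ^ 'n) \<times> real \<times> real \<Rightarrow> bool" where
  "alsox_optimal P \<epsilon> \<theta> q c S b X t =
     is_arg_min (alsox_objective P \<epsilon> \<theta> q S b) (alsox_feasible c X t)"

definition v_alsox ::
  "(real ^ 'n) measure \<Rightarrow> (real \<Rightarrow> real) \<Rightarrow> real \<Rightarrow> real \<Rightarrow> real \<Rightarrow> real ^ 'n \<Rightarrow> real ^ 'n \<Rightarrow>
   real ^ 'n ^ 'n \<Rightarrow> real \<Rightarrow> (real ^ 'n) set \<Rightarrow> ereal" where
  "v_alsox P g \<epsilon> \<theta> q c m S b X =
     (INF t\<in>{t. \<exists>x l \<beta>. alsox_optimal P \<epsilon> \<theta> q c S b X t (x, l, \<beta>) \<and>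
                       wc_chance_constraint g \<epsilon> \<theta> q m S b x}. ereal t)"

end

theory Submission
  imports Defs
begin

text \<open>
  On binary vectors \<open>x\<^sub>i\<^sup>2 = x\<^sub>i\<close>, so with \<open>S = Diag \<mu>\<close> the variance \<open>x \<bullet> (S *v x)\<close> equals the mean
  \<open>\<mu> \<bullet> x\<close>. Both the worst-case constraint and the ALSO-X# objective therefore depend on \<open>x\<close> only
  through the number \<open>s = \<mu> \<bullet> x \<ge> 0\<close>, and both are monotone in it:

  \<^item> the left-hand side of the constraint is \<open>s + \<eta> * sqrt s - b\<close> with \<open>\<eta> \<ge> 0\<close>;
  \<^item> for fixed multipliers \<open>l\<close> and \<open>\<beta>\<close>, the objective contains the expected positive part of
    \<open>s + sqrt s * Z\<close> plus a penalty nondecreasing in \<open>sqrt s\<close>. The variable \<open>Z\<close> is symmetric, so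
    the expectation is unchanged when the integrand is averaged over \<open>Z\<close> and \<open>- Z\<close>, and
    \<open>(a + d)\<^sub>+ + (a - d)\<^sub>+\<close> grows with both \<open>a\<close> and \<open>\<bar>d\<bar>\<close>
    (\<open>positive_part_pair_mono\<close>, \<open>alsox_objective_mono\<close>).

  Given \<open>x\<close> satisfying the worst-case constraint, solve ALSO-X# with budget \<open>t = c \<bullet> x\<close> and compare
  an optimal solution \<open>(y, l, \<beta>)\<close> with \<open>x\<close>. If \<open>\<mu> \<bullet> y \<le> \<mu> \<bullet> x\<close>, then \<open>y\<close> inherits the constraint
  from \<open>x\<close>. Otherwise \<open>(x, l, \<beta>)\<close> is no worse than \<open>(y, l, \<beta>)\<close>, hence it is an optimal solution
  too, and it satisfies the constraint. In either case the budget \<open>c \<bullet> x\<close> is accepted by ALSO-X#.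
  The reverse inequality holds because every accepted budget bounds the cost of a feasible point.
\<close>

lemma inner_Diag_binary:
  fixes m x :: "real ^ 'n"
  assumes "\<forall>i. x $ i \<in> {0, 1}"
  shows "x \<bullet> (Diag m *v x) = m \<bullet> x"
proof -
  have binary: "x $ i * (m $ i * x $ i) = m $ i * x $ i" for i
    using assms[rule_format, of i] by auto
  have "(Diag m *v x) $ i = m $ i * x $ i" for i
    by (simp add: matrix_vector_mult_def Diag_def if_distrib[of "\<lambda>y. y * _"] cong: if_cong)
  then show ?thesis
    unfolding inner_vec_def by (simp only: inner_real_def binary)
qed

lemma nn_integral_std_elliptical_uminus:
  assumes g: "generating_function g" and f: "f \<in> borel_measurable borel"
  shows "(\<integral>\<^sup>+z. f (- z) \<partial>std_elliptical g) = (\<integral>\<^sup>+z. f z \<partial>std_elliptical g)"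
proof -
  have "integrable lborel (\<lambda>z. g (z\<^sup>2 / 2))"
    using g by (simp add: generating_function_def)
  then have "(\<lambda>z. g (z\<^sup>2 / 2)) \<in> borel_measurable borel"
    using borel_measurable_integrable by force
  then have [measurable]: "std_density g \<in> borel_measurable borel"
    unfolding std_density_def[abs_def] by (rule borel_measurable_times[OF borel_measurable_const])
  note [measurable] = f
  have "(\<integral>\<^sup>+z. f z \<partial>std_elliptical g) = (\<integral>\<^sup>+z. ennreal (std_density g z) * f z \<partial>lborel)"
    unfolding std_elliptical_def by (simp add: nn_integral_density)
  also have "\<dots> = (\<integral>\<^sup>+z. ennreal (std_density g (- z)) * f (- z) \<partial>lborel)"
    by (subst nn_integral_real_affine[where c = "-1" and t = 0]) simp_all
  also have "\<dots> = (\<integral>\<^sup>+z. f (- z) \<partial>std_elliptical g)"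
  proof -
    have "std_density g (- z) = std_density g z" for z
      by (simp add: std_density_def)
    then show ?thesis
      unfolding std_elliptical_def by (simp add: nn_integral_density)
  qed
  finally show ?thesis by simp
qed

text \<open>The left-hand side is \<open>max (a + \<bar>a\<bar>) (a + \<bar>d\<bar>)\<close>, as \<open>ennreal\<close> is the positive part.\<close>

lemma positive_part_pair_mono:
  assumes "a \<le> a'" "\<bar>d\<bar> \<le> \<bar>d'\<bar>"
  shows "ennreal (a + d) + ennreal (a - d) \<le> ennreal (a' + d') + ennreal (a' - d')"
proof -
  have pos: "ennreal u + ennreal v = ennreal (max 0 u + max 0 v)" for u v
    by (simp add: ennreal_plus[symmetric] max_def ennreal_neg del: ennreal_plus)
  show ?thesis
    unfolding pos using assms by (intro ennreal_leI) linarith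
qed

text \<open>For a fixed \<open>z\<close> of the wrong sign the integrand decreases in \<open>s\<close>. Adding its reflection, which
  has the same integral, repairs this pointwise. The argument works with nonnegative integrals
  throughout, so the values may be infinite.\<close>

lemma nn_integral_positive_part_mono:
  assumes g: "generating_function g" and "a \<le> a'" "0 \<le> s" "s \<le> s'"
  shows "(\<integral>\<^sup>+z. ennreal (a + s * z) \<partial>std_elliptical g) \<le>
    (\<integral>\<^sup>+z. ennreal (a' + s' * z) \<partial>std_elliptical g)"
proof -
  define I where "I a s = (\<integral>\<^sup>+z. ennreal (a + s * z) \<partial>std_elliptical g)" for a s
  have sets: "sets (std_elliptical g) = sets borel"
    by (simp add: std_elliptical_def)
  have double: "I a s + I a s =
      (\<integral>\<^sup>+z. ennreal (a + s * z) + ennreal (a - s * z) \<partial>std_elliptical g)" for a s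
  proof -
    have "I a s = (\<integral>\<^sup>+z. ennreal (a - s * z) \<partial>std_elliptical g)"
      using nn_integral_std_elliptical_uminus[OF g, of "\<lambda>z. ennreal (a + s * z)"]
      by (simp add: I_def)
    then have "I a s + I a s = (\<integral>\<^sup>+z. ennreal (a + s * z) \<partial>std_elliptical g)
        + (\<integral>\<^sup>+z. ennreal (a - s * z) \<partial>std_elliptical g)"
      by (simp add: I_def)
    also have "\<dots> = (\<integral>\<^sup>+z. ennreal (a + s * z) + ennreal (a - s * z) \<partial>std_elliptical g)"
      by (intro nn_integral_add[symmetric]) (simp_all add: measurable_cong_sets[OF sets refl])
    finally show ?thesis .
  qed
  have "I a s + I a s \<le> I a' s' + I a' s'"
    unfolding double using assms(2-4)
    by (intro nn_integral_mono positive_part_pair_mono) (auto simp: abs_mult intro: mult_right_mono)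
  then have "I a s \<le> I a' s'"
    by (rule contrapos_pp) (simp add: not_le add_strict_mono)
  then show ?thesis
    by (simp add: I_def)
qed

lemma penalty_mono:
  assumes "1 \<le> q" "dual_norm S x \<le> dual_norm S y" "0 \<le> dual_norm S x"
  shows "penalty q S x l \<le> penalty q S y l"
proof -
  have "dual_norm S x powr (q / (q - 1)) \<le> dual_norm S y powr (q / (q - 1))" if "q \<noteq> 1"
    using assms that by (intro powr_mono2) auto
  moreover have "0 \<le> l powr (- 1 / (q - 1))" "0 \<le> q powr (- q / (q - 1))" "0 \<le> q - 1"
    using assms(1) by auto
  ultimately have "q \<noteq> 1 \<Longrightarrow> dual_norm S x powr (q / (q - 1)) * l powr (- 1 / (q - 1)) *
      q powr (- q / (q - 1)) * (q - 1) \<le> dual_norm S y powr (q / (q - 1)) *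
      l powr (- 1 / (q - 1)) * q powr (- q / (q - 1)) * (q - 1)"
    by (intro mult_right_mono)
  then show ?thesis
    using assms(2,3) unfolding penalty_def by simp
qed

lemma nn_integral_elliptical:
  assumes ell: "elliptical P m S g" and f: "f \<in> borel_measurable borel"
  shows "(\<integral>\<^sup>+\<zeta>. f (x \<bullet> \<zeta>) \<partial>P) =
    (\<integral>\<^sup>+z. f (m \<bullet> x + dual_norm S x * z) \<partial>std_elliptical g)"
proof -
  have sets: "sets P = sets borel"
    using ell by (simp add: elliptical_def)
  have "(\<lambda>\<zeta>. x \<bullet> \<zeta>) \<in> borel_measurable P"
    by (simp add: measurable_cong_sets[OF sets refl])
  then have "(\<integral>\<^sup>+\<zeta>. f (x \<bullet> \<zeta>) \<partial>P) = (\<integral>\<^sup>+u. f u \<partial>distr P borel (\<lambda>\<zeta>. x \<bullet> \<zeta>))"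
    using f by (simp add: nn_integral_distr)
  also have "\<dots> = (\<integral>\<^sup>+u. f u \<partial>distr (std_elliptical g) borel (\<lambda>z. m \<bullet> x + dual_norm S x * z))"
    using ell by (simp add: elliptical_def dual_norm_def)
  also have "\<dots> = (\<integral>\<^sup>+z. f (m \<bullet> x + dual_norm S x * z) \<partial>std_elliptical g)"
    using f by (subst nn_integral_distr) (simp_all add: std_elliptical_def)
  finally show ?thesis .
qed

text \<open>This allows an optimal vector to be exchanged for one of smaller mean and dispersion without
  touching the multipliers \<open>l\<close> and \<open>\<beta>\<close>: the penalty is monotone in the dispersion, and symmetry of
  the standard law takes care of the expectation. The penalty may be infinite, which is why the
  proof splits on it.\<close>

lemma alsox_objective_mono:
  assumes q: "1 \<le> q" and ell: "elliptical P m S g"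
    and mean: "m \<bullet> x \<le> m \<bullet> y" and disp: "dual_norm S x \<le> dual_norm S y"
  shows "alsox_objective P \<epsilon> \<theta> q S b (x, l, \<beta>) \<le> alsox_objective P \<epsilon> \<theta> q S b (y, l, \<beta>)"
proof -
  have g: "generating_function g" and "psd S"
    using ell by (auto simp: elliptical_def)
  then have disp_nonneg: "0 \<le> dual_norm S x"
    by (simp add: dual_norm_def psd_def)
  define f where "f p u = e2ennreal (max 0 (ereal (u - b) + p - ereal \<beta>))" for p u
  have f_measurable: "f p \<in> borel_measurable borel" for p
    unfolding f_def by measurable
  have f_finite: "f (ereal r) u = ennreal (u - b + r - \<beta>)" for r u
    by (simp add: f_def e2ennreal_ereal ennreal_def flip: ereal_max zero_ereal_def)
  let ?p = "penalty q S x l" and ?p' = "penalty q S y l"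
  have pen: "?p \<le> ?p'"
    using penalty_mono[OF q disp disp_nonneg] .
  have "(\<integral>\<^sup>+z. f ?p (m \<bullet> x + dual_norm S x * z) \<partial>std_elliptical g) \<le>
    (\<integral>\<^sup>+z. f ?p' (m \<bullet> y + dual_norm S y * z) \<partial>std_elliptical g)"
  proof (cases ?p')
    case PInf
    then have "f ?p' u = \<top>" for u
      by (simp add: f_def max_def)
    then show ?thesis
      by (intro nn_integral_mono) simp
  next
    case MInf
    then show ?thesis
      using pen by (simp add: f_def max_def)
  next
    case (real r')
    show ?thesis
    proof (cases ?p)
      case (real r)
      have "(\<integral>\<^sup>+z. ennreal (m \<bullet> x - b + r - \<beta> + dual_norm S x * z) \<partial>std_elliptical g) \<le>
        (\<integral>\<^sup>+z. ennreal (m \<bullet> y - b + r' - \<beta> + dual_norm S y * z) \<partial>std_elliptical g)"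
        using pen mean disp disp_nonneg real \<open>?p' = ereal r'\<close>
        by (intro nn_integral_positive_part_mono[OF g]) auto
      then show ?thesis
        by (simp add: real \<open>?p' = ereal r'\<close> f_finite algebra_simps)
    next
      case PInf
      then show ?thesis
        using pen real by simp
    next
      case MInf
      then show ?thesis
        by (simp add: f_def max_def)
    qed
  qed
  then have "(\<integral>\<^sup>+\<zeta>. f ?p (x \<bullet> \<zeta>) \<partial>P) \<le> (\<integral>\<^sup>+\<zeta>. f ?p' (y \<bullet> \<zeta>) \<partial>P)"
    by (simp add: nn_integral_elliptical[OF ell f_measurable])
  then show ?thesis
    unfolding alsox_objective_def f_def
    by (auto intro!: add_left_mono simp: less_eq_ennreal.rep_eq)
qed

theorem corollary10:
  fixes P :: "(real ^ 'n) measure" and g :: "real \<Rightarrow> real"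
    and c \<mu> :: "real ^ 'n" and S :: "real ^ 'n ^ 'n"
    and X :: "(real ^ 'n) set" and b \<epsilon> \<theta> q :: real
  assumes q: "1 \<le> q"
    and \<epsilon>: "0 < \<epsilon>" "\<epsilon> < 1"
    and \<theta>: "0 \<le> \<theta>"
    and ell: "elliptical P \<mu> S g"
    and subg: "sub_gaussian P"
    and X: "X \<subseteq> {x. \<forall>i. x $ i \<in> {0, 1}}"
    and \<mu>: "\<forall>i. 0 \<le> \<mu> $ i"
    and S: "S = Diag \<mu>"
    and eta: "0 \<le> eta_star g \<epsilon> \<theta> q"
    and attained: "\<And>t. (\<exists>s. alsox_feasible c X t s) \<Longrightarrow> (\<exists>s. alsox_optimal P \<epsilon> \<theta> q c S b X t s)"
  shows "v_alsox P g \<epsilon> \<theta> q c \<mu> S b X = v_star g \<epsilon> \<theta> q c \<mu> S b X"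
proof (rule antisym)
  let ?wc = "wc_chance_constraint g \<epsilon> \<theta> q \<mu> S b"
  let ?obj = "alsox_objective P \<epsilon> \<theta> q S b"
  let ?opt = "alsox_optimal P \<epsilon> \<theta> q c S b X"
  have variance: "x \<bullet> (S *v x) = \<mu> \<bullet> x" if "x \<in> X" for x
    unfolding S using that X by (intro inner_Diag_binary) blast
  have accepted: "\<exists>y l \<beta>. ?opt (c \<bullet> x) (y, l, \<beta>) \<and> ?wc y" if x: "x \<in> X" "?wc x" for x
  proof -
    have "alsox_feasible c X (c \<bullet> x) (x, 0, 0)"
      using x by (simp add: alsox_feasible_def)
    then obtain s where "?opt (c \<bullet> x) s"
      using attained[of "c \<bullet> x"] by blast
    moreover obtain y l \<beta> where "s = (y, l, \<beta>)"
      by (rule prod_cases3)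
    ultimately have opt: "?opt (c \<bullet> x) (y, l, \<beta>)"
      by simp
    then have feas: "alsox_feasible c X (c \<bullet> x) (y, l, \<beta>)"
      and least: "\<And>s. alsox_feasible c X (c \<bullet> x) s \<Longrightarrow> ?obj (y, l, \<beta>) \<le> ?obj s"
      by (auto simp: alsox_optimal_def is_arg_min_linorder)
    have y: "y \<in> X"
      using feas by (simp add: alsox_feasible_def)
    \<comment> \<open>Of \<open>x\<close> and \<open>y\<close>, the one with the smaller mean is both optimal and feasible.\<close>
    show ?thesis
    proof (cases "\<mu> \<bullet> y \<le> \<mu> \<bullet> x")
      case True
      then have "eta_star g \<epsilon> \<theta> q * sqrt (\<mu> \<bullet> y) \<le> eta_star g \<epsilon> \<theta> q * sqrt (\<mu> \<bullet> x)"
        using eta by (intro mult_left_mono) auto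
      then have "?wc y"
        using True x y by (simp add: wc_chance_constraint_def variance)
      with opt show ?thesis by blast
    next
      case False
      then have "?obj (x, l, \<beta>) \<le> ?obj (y, l, \<beta>)"
        by (intro alsox_objective_mono[OF q ell]) (simp_all add: dual_norm_def variance x y)
      moreover have "alsox_feasible c X (c \<bullet> x) (x, l, \<beta>)"
        using feas x by (simp add: alsox_feasible_def)
      ultimately have "?opt (c \<bullet> x) (x, l, \<beta>)"
        using least by (auto simp: alsox_optimal_def is_arg_min_linorder intro: order_trans)
      with x show ?thesis by blast
    qed
  qed
  show "v_alsox P g \<epsilon> \<theta> q c \<mu> S b X \<le> v_star g \<epsilon> \<theta> q c \<mu> S b X"
    unfolding v_star_def
  proof (rule INF_greatest)
    fix x assume "x \<in> {x \<in> X. ?wc x}"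
    then show "v_alsox P g \<epsilon> \<theta> q c \<mu> S b X \<le> ereal (c \<bullet> x)"
      unfolding v_alsox_def using accepted by (intro INF_lower) blast
  qed
  show "v_star g \<epsilon> \<theta> q c \<mu> S b X \<le> v_alsox P g \<epsilon> \<theta> q c \<mu> S b X"
    unfolding v_alsox_def
  proof (rule INF_greatest)
    fix t assume "t \<in> {t. \<exists>x l \<beta>. ?opt t (x, l, \<beta>) \<and> ?wc x}"
    then obtain x l \<beta> where "?opt t (x, l, \<beta>)" and wc: "?wc x"
      by blast
    then have "x \<in> X" "c \<bullet> x \<le> t"
      by (auto simp: alsox_optimal_def is_arg_min_def alsox_feasible_def)
    then show "v_star g \<epsilon> \<theta> q c \<mu> S b X \<le> ereal t"
      unfolding v_star_def using wc by (intro INF_lower2[of x]) auto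
  qed
qed

end
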